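(* There is a constant $C>0$, independent of $k,h,\gamma$, such that for all $k>0$, $h>0$ with $t:=kh\le 1$ and all real $\gamma$ with $-\frac16\le\gamma\le\frac16$: (i) $\left|\cos t_h^--1+\frac{t^2}{2}\right|\le\frac16t^4$ and $|k_h^--k|\le C\,k^3h^2$; (ii) if $\gamma=-\frac1{12}$, then $|k_h^--k|\le C\,k^5h^4$. (iii) Moreover, for every $M>0$ there is a constant $C_M>0$, depending only on $M$, such that for all such $k,h,\gamma$: if $|\gamma-\gamma_o|\le\frac{M}{k^2h}$, where $$\gamma_o=\frac{6\cos t-6+t^2\cos t+2t^2}{12(1-\cos t)^2},$$ then $|k_h^--k|\le C_M\,kh$.
   Context: For $t=kh\in(0,1]$ and $\gamma\in[-\frac16,\frac16]$, the number $t_h^-\in(0,\pi/2)$ is defined by $$\cos t_h^-=\frac{4\gamma+1+\frac{t^2}{6}-\sqrt{\left(1+\frac{t^2}{6}\right)^2+4\gamma t^2}}{4\gamma}$$ for $\gamma\ne0$, equivalently (and, for $\gamma=0$, by definition) $$1-\cos t_h^-=\frac{t^2}{1+\frac{t^2}{6}+\sqrt{\left(1+\frac{t^2}{6}\right)^2+4\gamma t^2}}.$$ The discrete wave number is $k_h^-:=t_h^-/h$. (It is the wave number of the propagating discrete plane wave $v_j=e^{\mathbf{i}k_h^-jh}$ solving the interior finite element equations $\gamma v_{j-2}+Rv_{j-1}+2Sv_j+Rv_{j+1}+\gamma v_{j+2}=0$ with $R=-1-4\gamma-t^2/6$, $S=1+3\gamma-t^2/3$.) *)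

theory Defs
  imports Complex_Main
begin

text \<open>The value prescribed for \<open>cos t\<^sub>h\<^sup>-\<close>. The first formula is undefined at
  \<open>\<gamma> = 0\<close>, where the rationalised form is used; lemma \<open>cos_value_rationalised\<close>
  below shows that the two agree for \<open>\<gamma> \<noteq> 0\<close>.\<close>

definition cos_value :: "real \<Rightarrow> real \<Rightarrow> real" where
  "cos_value t \<gamma> =
     (if \<gamma> \<noteq> 0
      then (4 * \<gamma> + 1 + t\<^sup>2 / 6 - sqrt ((1 + t\<^sup>2 / 6)\<^sup>2 + 4 * \<gamma> * t\<^sup>2)) / (4 * \<gamma>)
      else 1 - t\<^sup>2 / (1 + t\<^sup>2 / 6 + sqrt ((1 + t\<^sup>2 / 6)\<^sup>2 + 4 * \<gamma> * t\<^sup>2)))"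

definition t_minus :: "real \<Rightarrow> real \<Rightarrow> real" where
  "t_minus t \<gamma> = (THE \<theta>. 0 < \<theta> \<and> \<theta> < pi / 2 \<and> cos \<theta> = cos_value t \<gamma>)"

definition k_minus :: "real \<Rightarrow> real \<Rightarrow> real \<Rightarrow> real" where
  "k_minus k h \<gamma> = t_minus (k * h) \<gamma> / h"

definition gamma_o :: "real \<Rightarrow> real" where
  "gamma_o t = (6 * cos t - 6 + t\<^sup>2 * cos t + 2 * t\<^sup>2) / (12 * (1 - cos t)\<^sup>2)"

lemma radicand_bound:
  fixes t \<gamma> :: real
  assumes "-1/6 \<le> \<gamma>"
  shows "(1 - t\<^sup>2 / 6)\<^sup>2 \<le> (1 + t\<^sup>2 / 6)\<^sup>2 + 4 * \<gamma> * t\<^sup>2"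
proof -
  have "0 \<le> (\<gamma> + 1/6) * t\<^sup>2" using assms by simp
  then show ?thesis by (simp add: power2_eq_square field_simps)
qed

lemma cos_value_rationalised:
  fixes t \<gamma> :: real
  assumes "-1/6 \<le> \<gamma>"
  shows "1 - cos_value t \<gamma> =
    t\<^sup>2 / (1 + t\<^sup>2 / 6 + sqrt ((1 + t\<^sup>2 / 6)\<^sup>2 + 4 * \<gamma> * t\<^sup>2))"
proof (cases "\<gamma> = 0")
  case False
  define A where "A = 1 + t\<^sup>2 / 6"
  define r where "r = sqrt (A\<^sup>2 + 4 * \<gamma> * t\<^sup>2)"
  have "0 \<le> A\<^sup>2 + 4 * \<gamma> * t\<^sup>2"
    using radicand_bound[OF assms, of t] zero_le_power2[of "1 - t\<^sup>2/6"] 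
    unfolding A_def by linarith
  then have r: "r * r = A * A + 4 * \<gamma> * t\<^sup>2" "0 \<le> r"
    by (simp_all add: r_def power2_eq_square)
  have "A > 0" using zero_le_power2[of t] unfolding A_def by linarith
  with r have pos: "A + r > 0" by linarith
  have "1 - cos_value t \<gamma> = (r - A) / (4 * \<gamma>)"
    using False by (simp add: cos_value_def r_def A_def field_simps)
  also have "\<dots> = t\<^sup>2 / (A + r)"
    using False pos r(1) by (simp add: frac_eq_eq algebra_simps)
  finally show ?thesis by (simp add: A_def r_def)
qed (simp add: cos_value_def)

lemma t_minus_unique_existence:
  fixes t \<gamma> :: real
  assumes "0 < t" "t \<le> 1" "-1/6 \<le> \<gamma>"
  shows "\<exists>!\<theta>. 0 < \<theta> \<and> \<theta> < pi / 2 \<and> cos \<theta> = cos_value t \<gamma>"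
proof -
  define d where "d = 1 + t\<^sup>2 / 6 + sqrt ((1 + t\<^sup>2 / 6)\<^sup>2 + 4 * \<gamma> * t\<^sup>2)"
  have t2: "0 < t\<^sup>2" "t\<^sup>2 \<le> 1" using assms by (simp_all add: power_le_one)
  have "1 - t\<^sup>2 / 6 \<le> sqrt ((1 + t\<^sup>2 / 6)\<^sup>2 + 4 * \<gamma> * t\<^sup>2)"
    by (rule real_le_rsqrt[OF radicand_bound[OF assms(3)]])
  then have d: "d \<ge> 2" unfolding d_def by linarith
  have c: "1 - cos_value t \<gamma> = t\<^sup>2 / d"
    using cos_value_rationalised[OF assms(3)] by (simp add: d_def)
  have "0 < t\<^sup>2 / d" "t\<^sup>2 / d < 1" using t2 d by simp_all
  with c have b: "0 < cos_value t \<gamma>" "cos_value t \<gamma> < 1" by linarith+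
  show ?thesis
  proof (rule ex1I[of _ "arccos (cos_value t \<gamma>)"])
    have "arccos (cos_value t \<gamma>) < arccos 0" "arccos 1 < arccos (cos_value t \<gamma>)"
      using b by (intro arccos_less_arccos; simp)+
    then show "0 < arccos (cos_value t \<gamma>) \<and> arccos (cos_value t \<gamma>) < pi / 2 \<and>
        cos (arccos (cos_value t \<gamma>)) = cos_value t \<gamma>"
      using b by (simp add: arccos_0)
  next
    fix \<theta> assume "0 < \<theta> \<and> \<theta> < pi / 2 \<and> cos \<theta> = cos_value t \<gamma>"
    then show "\<theta> = arccos (cos_value t \<gamma>)"
      using arccos_cos[of \<theta>] pi_gt_zero by simp
  qed
qed

end

theory Submission
  imports Defs
begin

text \<open>
  Put \<open>s = t\<^sup>2\<close> and \<open>A = 1 + s/6\<close>. The number \<open>x = 1 - cos t\<^sub>h\<^sup>-\<close> is a root of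
  \<open>p(x) = 2 A x + 4 \<gamma> x\<^sup>2 - s\<close>, whose difference quotients on \<open>[0, 1/2]\<close> are at least \<open>1\<close>;
  hence \<open>x\<close> differs from \<open>x\<^sub>0 = 1 - cos t\<close> by at most \<open>\<bar>p(x\<^sub>0)\<bar>\<close>. The parameter \<open>\<gamma>\<^sub>o\<close> is the
  value of \<open>\<gamma>\<close> with \<open>p(x\<^sub>0) = 0\<close>, so that \<open>p(x\<^sub>0) = 4 (\<gamma> - \<gamma>\<^sub>o) x\<^sub>0\<^sup>2\<close> in general, and
  \<open>\<gamma> = -1/12\<close> is the value for which the terms of order \<open>s\<^sup>2\<close> in \<open>p(x\<^sub>0)\<close> cancel. Errors in the
  cosine become errors in the angle at the cost of a factor of order \<open>1/t\<close>, since
  \<open>cos a - cos b = 2 sin ((a + b)/2) sin ((b - a)/2)\<close>.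
\<close>

section \<open>Elementary estimates for sine and cosine\<close>

lemma sin_ge_third:
  fixes y :: real
  assumes "0 \<le> y" "y \<le> 2"
  shows "y / 3 \<le> sin y"
proof -
  have "\<bar>sin y - (\<Sum>m<3. sin_coeff m * y ^ m)\<bar> \<le> inverse (fact 3) * \<bar>y\<bar> ^ 3"
    by (rule Maclaurin_sin_bound)
  then have "\<bar>sin y - y\<bar> \<le> y ^ 3 / 6"
    using assms(1) by (simp add: lessThan_nat_numeral sin_coeff_def fact_numeral)
  \<comment> \<open>The range \<open>y \<le> 2\<close> keeps the cubic remainder below
    \<open>2 * y / 3\<close>, which leaves \<open>y / 3\<close> for the sine.\<close>
  moreover have "y ^ 3 \<le> 4 * y"
  proof -
    have "y * y \<le> 2 * 2" using assms by (intro mult_mono) auto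
    then have "y * y * y \<le> 4 * y" using assms(1) by (intro mult_right_mono) auto
    then show ?thesis by (simp add: power3_eq_cube)
  qed
  ultimately show ?thesis by linarith
qed

text \<open>Both sine factors in the product formula for \<open>cos b - cos a\<close> have arguments
  of size at most 2, so each is at least a third of its argument in absolute value. Of
  \<open>a + b\<close> only \<open>a\<close> is kept, and the constant is 6 * 6 / 2 = 18.\<close>

lemma angle_diff_le_cos_diff:
  fixes a b :: real
  assumes "0 < a" "a \<le> 2" "0 < b" "b \<le> 2"
  shows "a * \<bar>b - a\<bar> \<le> 18 * \<bar>cos b - cos a\<bar>"
proof -
  have "a / 6 \<le> (a + b) / 6" using assms by simp
  also have "\<dots> \<le> sin ((a + b) / 2)"
    using sin_ge_third[of "(a + b) / 2"] assms by simp
  finally have sum: "a / 6 \<le> sin ((a + b) / 2)" .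
  have diff: "\<bar>b - a\<bar> / 6 \<le> \<bar>sin ((a - b) / 2)\<bar>"
  proof -
    have "\<bar>a - b\<bar> / 6 \<le> sin (\<bar>a - b\<bar> / 2)"
      using sin_ge_third[of "\<bar>a - b\<bar> / 2"] assms by simp
    also have "\<dots> \<le> \<bar>sin ((a - b) / 2)\<bar>"
    proof -
      have "sin ((b - a) / 2) = - sin ((a - b) / 2)"
        by (metis minus_diff_eq minus_divide_left sin_minus)
      then show ?thesis by (auto simp: abs_real_def)
    qed
    finally show ?thesis by (simp add: abs_minus_commute)
  qed
  have "a / 6 * (\<bar>b - a\<bar> / 6) \<le> sin ((a + b) / 2) * \<bar>sin ((a - b) / 2)\<bar>"
    using assms sum diff by (intro mult_mono) auto
  moreover have "\<bar>cos b - cos a\<bar> = 2 * (sin ((a + b) / 2) * \<bar>sin ((a - b) / 2)\<bar>)"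
  proof -
    have "0 \<le> sin ((a + b) / 2)" using sum assms by linarith
    moreover have "cos b - cos a = 2 * sin ((b + a) / 2) * sin ((a - b) / 2)"
      by (rule cos_diff_cos)
    ultimately show ?thesis by (simp add: abs_mult add.commute)
  qed
  ultimately show ?thesis by simp
qed

lemma cos_taylor4:
  fixes t :: real
  shows "\<bar>1 - cos t - t\<^sup>2 / 2\<bar> \<le> t ^ 4 / 24"
proof -
  obtain u where u: "cos t = (\<Sum>m<4. cos_coeff m * t ^ m) + cos (u + 1/2 * real 4 * pi) / fact 4 * t ^ 4"
    using Maclaurin_cos_expansion[of t 4] by blast
  define c where "c = cos (u + 1/2 * real 4 * pi)"
  have eq: "cos t = 1 - t\<^sup>2 / 2 + c * (t ^ 4 / 24)"
    using u unfolding c_def[symmetric] by (simp add: lessThan_nat_numeral cos_coeff_def fact_numeral)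
  have "\<bar>c\<bar> * (t ^ 4 / 24) \<le> 1 * (t ^ 4 / 24)"
    by (intro mult_right_mono) (auto simp: c_def)
  moreover have "\<bar>1 - cos t - t\<^sup>2 / 2\<bar> = \<bar>c\<bar> * (t ^ 4 / 24)"
    unfolding eq by (simp add: abs_mult)
  ultimately show ?thesis by linarith
qed

text \<open>The quartic term is made explicit here because for \<gamma> = -1/12 it has to cancel
  exactly.\<close>

lemma cos_taylor6:
  fixes t :: real
  shows "\<bar>1 - cos t - (t\<^sup>2 / 2 - t ^ 4 / 24)\<bar> \<le> t ^ 6 / 720"
proof -
  obtain u where u: "cos t = (\<Sum>m<6. cos_coeff m * t ^ m) + cos (u + 1/2 * real 6 * pi) / fact 6 * t ^ 6"
    using Maclaurin_cos_expansion[of t 6] by blast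
  define c where "c = cos (u + 1/2 * real 6 * pi)"
  have eq: "cos t = 1 - t\<^sup>2 / 2 + t ^ 4 / 24 + c * (t ^ 6 / 720)"
    using u unfolding c_def[symmetric] by (simp add: lessThan_nat_numeral cos_coeff_def fact_numeral)
  have "\<bar>c\<bar> * (t ^ 6 / 720) \<le> 1 * (t ^ 6 / 720)"
    by (intro mult_right_mono) (auto simp: c_def)
  moreover have "\<bar>1 - cos t - (t\<^sup>2 / 2 - t ^ 4 / 24)\<bar> = \<bar>c\<bar> * (t ^ 6 / 720)"
    unfolding eq by (simp add: abs_mult)
  ultimately show ?thesis by linarith
qed

lemma one_minus_cos_le:
  fixes t :: real
  shows "1 - cos t \<le> t\<^sup>2 / 2"
proof -
  have "cos t = 1 - 2 * (sin (t / 2))\<^sup>2"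
    using cos_double_sin[of "t / 2"] by simp
  moreover have "(sin (t / 2))\<^sup>2 \<le> (t / 2)\<^sup>2"
    using abs_sin_x_le_abs_x[of "t / 2"] by (simp only: abs_le_square_iff)
  ultimately show ?thesis by (simp add: power_divide)
qed

section \<open>The discrete angle and its cosine\<close>

lemma t_minus_works:
  assumes "0 < t" "t \<le> 1" "-1/6 \<le> \<gamma>"
  shows "0 < t_minus t \<gamma>" "t_minus t \<gamma> < pi / 2" "cos (t_minus t \<gamma>) = cos_value t \<gamma>"
  using theI'[OF t_minus_unique_existence[OF assms]] by (simp_all add: t_minus_def)

text \<open>The radicand increases with \<gamma>. At -1/6 it equals
  \<open>(1 - t\<^sup>2 / 6)\<^sup>2\<close>; at 1/6 it is
  \<open>1 + t\<^sup>2 + t ^ 4 / 36\<close>, which is at most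
  \<open>(1 + t\<^sup>2 / 2)\<^sup>2\<close>.\<close>

lemma radical_bounds:
  fixes t \<gamma> :: real
  assumes "-1/6 \<le> \<gamma>" "\<gamma> \<le> 1/6"
  defines "r \<equiv> sqrt ((1 + t\<^sup>2 / 6)\<^sup>2 + 4 * \<gamma> * t\<^sup>2)"
  shows "1 - t\<^sup>2 / 6 \<le> r" "r \<le> 1 + t\<^sup>2 / 2"
proof -
  show "1 - t\<^sup>2 / 6 \<le> r"
    unfolding r_def by (rule real_le_rsqrt[OF radicand_bound[OF assms(1)]])
  have "4 * \<gamma> * t\<^sup>2 \<le> 4 * (1/6) * t\<^sup>2"
    using assms(2) by (intro mult_right_mono) auto
  moreover have "(1 + t\<^sup>2 / 2)\<^sup>2 - (1 + t\<^sup>2 / 6)\<^sup>2 = 2 / 3 * t\<^sup>2 + 2 / 9 * (t\<^sup>2)\<^sup>2"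
    by (simp add: power2_eq_square field_simps)
  ultimately have "(1 + t\<^sup>2 / 6)\<^sup>2 + 4 * \<gamma> * t\<^sup>2 \<le> (1 + t\<^sup>2 / 2)\<^sup>2"
    using zero_le_power2[of "t\<^sup>2"] by linarith
  then show "r \<le> 1 + t\<^sup>2 / 2"
    unfolding r_def by (intro real_le_lsqrt) auto
qed

lemma cos_value_bounds:
  fixes t \<gamma> :: real
  assumes "0 < t" "t \<le> 1" "-1/6 \<le> \<gamma>" "\<gamma> \<le> 1/6"
  defines "x \<equiv> 1 - cos_value t \<gamma>"
  shows "0 < x" "x \<le> t\<^sup>2 / 2" "\<bar>x - t\<^sup>2 / 2\<bar> \<le> 1/6 * t ^ 4"
    and "2 * (1 + t\<^sup>2 / 6) * x + 4 * \<gamma> * x\<^sup>2 = t\<^sup>2"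
proof -
  define A where "A = 1 + t\<^sup>2 / 6"
  define r where "r = sqrt (A\<^sup>2 + 4 * \<gamma> * t\<^sup>2)"
  have r: "1 - t\<^sup>2 / 6 \<le> r" "r \<le> 1 + t\<^sup>2 / 2"
    using radical_bounds[OF assms(3,4), of t] by (simp_all add: r_def A_def)
  have t2: "0 < t\<^sup>2" "t\<^sup>2 \<le> 1"
    using assms(1,2) by (simp_all add: power_le_one)
  have d: "0 \<le> A + r - 2" "A + r - 2 \<le> 2 / 3 * t\<^sup>2"
    using r by (simp_all add: A_def)
  have eq: "x * (A + r) = t\<^sup>2"
    using cos_value_rationalised[OF assms(3), of t] r t2 by (simp add: x_def A_def r_def)
  show pos: "0 < x"
    using eq t2 d by (simp add: zero_less_mult_iff flip: eq)
  then have "x * 2 \<le> x * (A + r)"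
    using d by (intro mult_left_mono) auto
  then show le: "x \<le> t\<^sup>2 / 2" using eq by simp
  \<comment> \<open>The constant 1/6 arises here as 1/2 * 2/3 * 1/2, from the upper bounds for
    \<open>x\<close> and for \<open>A + r - 2\<close>.\<close>
  have "t\<^sup>2 / 2 - x = x * (A + r - 2) / 2"
    using eq by (simp add: algebra_simps)
  also have "\<dots> \<le> t\<^sup>2 / 2 * (2 / 3 * t\<^sup>2) / 2"
    using d pos le by (intro divide_right_mono mult_mono) auto
  also have "\<dots> = 1/6 * t ^ 4" by (simp add: eval_nat_numeral)
  finally show "\<bar>x - t\<^sup>2 / 2\<bar> \<le> 1/6 * t ^ 4" using le by simp
  have "0 \<le> A\<^sup>2 + 4 * \<gamma> * t\<^sup>2"
    using radicand_bound[OF assms(3), of t] zero_le_power2[of "1 - t\<^sup>2 / 6"]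
    unfolding A_def by linarith
  \<comment> \<open>Cancelling \<open>A + r\<close> makes \<open>r\<close> affine in
    \<open>x\<close>. Inserting this in \<open>eq\<close> removes the square root, with no separate
    case for \<gamma> = 0.\<close>
  then have "(r - A) * (A + r) = 4 * \<gamma> * t\<^sup>2"
    by (simp add: r_def algebra_simps flip: power2_eq_square)
  also have "\<dots> = 4 * \<gamma> * x * (A + r)"
    unfolding eq[symmetric] by simp
  finally have "r = A + 4 * \<gamma> * x"
    using d by simp
  then show "2 * (1 + t\<^sup>2 / 6) * x + 4 * \<gamma> * x\<^sup>2 = t\<^sup>2"
    using eq unfolding A_def[symmetric] by (simp add: power2_eq_square algebra_simps)
qed

section \<open>Errors of the angle\<close>

lemma angle_error:
  fixes t \<gamma> e :: real
  assumes "0 < t" "t \<le> 1" "-1/6 \<le> \<gamma>" "\<bar>cos_value t \<gamma> - cos t\<bar> \<le> t * e"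
  shows "\<bar>t_minus t \<gamma> - t\<bar> \<le> 18 * e"
proof -
  have "t * \<bar>t_minus t \<gamma> - t\<bar> \<le> 18 * \<bar>cos (t_minus t \<gamma>) - cos t\<bar>"
    \<comment> \<open>Since pi / 2 < 2, the discrete angle lies in the range where the sine estimate
      applies.\<close>
    using assms t_minus_works[OF assms(1-3)] pi_less_4
    by (intro angle_diff_le_cos_diff) auto
  then have "t * \<bar>t_minus t \<gamma> - t\<bar> \<le> t * (18 * e)"
    using assms(4) t_minus_works(3)[OF assms(1-3)] by simp
  then show ?thesis using assms(1) by simp
qed

lemma angle_error_general:
  fixes t \<gamma> :: real
  assumes "0 < t" "t \<le> 1" "-1/6 \<le> \<gamma>" "\<gamma> \<le> 1/6"
  shows "\<bar>t_minus t \<gamma> - t\<bar> \<le> 18 * t ^ 3"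
proof (rule angle_error[OF assms(1-3)])
  have "\<bar>cos_value t \<gamma> - cos t\<bar> \<le> t ^ 4 / 24 + 1/6 * t ^ 4"
    using cos_taylor4[of t] cos_value_bounds(3)[OF assms(1-4)] by linarith
  also have "\<dots> \<le> t ^ 4" by simp
  finally show "\<bar>cos_value t \<gamma> - cos t\<bar> \<le> t * t ^ 3" by (simp add: eval_nat_numeral)
qed

lemma cos_error_le_residual:
  fixes t \<gamma> :: real
  assumes "0 < t" "t \<le> 1" "-1/6 \<le> \<gamma>" "\<gamma> \<le> 1/6"
  defines "y \<equiv> 1 - cos t"
  shows "\<bar>cos_value t \<gamma> - cos t\<bar> \<le> \<bar>2 * (1 + t\<^sup>2 / 6) * y + 4 * \<gamma> * y\<^sup>2 - t\<^sup>2\<bar>"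
proof -
  define x where "x = 1 - cos_value t \<gamma>"
  note x = cos_value_bounds[OF assms(1-4), folded x_def]
  \<comment> \<open>\<open>q\<close> is the difference quotient of the quadratic between
    \<open>y\<close> and its root \<open>x\<close>. The bound -1/4 below is what
    \<open>q \<ge> 1\<close> requires.\<close>
  define q where "q = 2 * (1 + t\<^sup>2 / 6) + 4 * (\<gamma> * (y + x))"
  have y: "0 \<le> y" "y + x \<le> 1"
    using x one_minus_cos_le[of t] power_le_one[of t 2] assms(1,2) by (simp_all add: y_def)
  have "-1/4 \<le> -1/6 * (y + x)" using y by simp
  also have "\<dots> \<le> \<gamma> * (y + x)"
    using x y assms(3) by (intro mult_right_mono) auto
  finally have q: "1 \<le> q"
    using zero_le_power2[of t] unfolding q_def by argo
  have "2 * (1 + t\<^sup>2 / 6) * y + 4 * \<gamma> * y\<^sup>2 - t\<^sup>2 = q * (y - x)"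
    using x(4) by (simp add: q_def power2_eq_square field_simps)
  then have "\<bar>2 * (1 + t\<^sup>2 / 6) * y + 4 * \<gamma> * y\<^sup>2 - t\<^sup>2\<bar> = q * \<bar>y - x\<bar>"
    using q by (simp add: abs_mult)
  moreover have "1 * \<bar>y - x\<bar> \<le> q * \<bar>y - x\<bar>"
    using q by (intro mult_right_mono) auto
  ultimately show ?thesis by (simp add: x_def y_def)
qed

lemma angle_error_superconvergent:
  fixes t :: real
  assumes "0 < t" "t \<le> 1"
  shows "\<bar>t_minus t (-1/12) - t\<bar> \<le> 18 * t ^ 5"
proof (rule angle_error[OF assms])
  define s where "s = t\<^sup>2"
  define y where "y = 1 - cos t"
  define e where "e = y - (s / 2 - s\<^sup>2 / 24)"
  have s: "0 < s" "s \<le> 1" using assms by (simp_all add: s_def power_le_one)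
  have pow: "t ^ 4 = s\<^sup>2" "t ^ 6 = s ^ 3" by (simp_all add: s_def flip: power_mult)
  have e: "\<bar>e\<bar> \<le> s ^ 3 / 720"
    using cos_taylor6[of t] unfolding pow s_def[symmetric] by (simp add: e_def y_def)
  have y: "0 \<le> s / 2 - y" "s / 2 - y \<le> s\<^sup>2 / 24"
    using one_minus_cos_le[of t] cos_taylor4[of t]
    unfolding pow s_def[symmetric] y_def by (simp, linarith)
  \<comment> \<open>Completing the square turns \<open>(s * y - y\<^sup>2) / 3\<close> into
    \<open>s\<^sup>2 / 12 - (s / 2 - y)\<^sup>2 / 3\<close>, and \<open>s\<^sup>2 / 12\<close>
    cancels the quartic Taylor term of \<open>2 * y\<close>.\<close>
  have res: "2 * (1 + t\<^sup>2 / 6) * y + 4 * (-1/12) * y\<^sup>2 - t\<^sup>2 = 2 * e - (s / 2 - y)\<^sup>2 / 3"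
    unfolding e_def s_def[symmetric] by (simp add: field_simps eval_nat_numeral)
  have "(s / 2 - y)\<^sup>2 \<le> (s\<^sup>2 / 24)\<^sup>2"
    using y by (intro power_mono)
  also have "\<dots> = s * s ^ 3 / 576"
    by (simp add: eval_nat_numeral)
  also have "\<dots> \<le> 1 * s ^ 3 / 576"
    using s by (intro divide_right_mono mult_right_mono) auto
  finally have sq: "(s / 2 - y)\<^sup>2 \<le> s ^ 3 / 576" by simp
  have "\<bar>cos_value t (-1/12) - cos t\<bar> \<le> \<bar>2 * (1 + t\<^sup>2 / 6) * y + 4 * (-1/12) * y\<^sup>2 - t\<^sup>2\<bar>"
    unfolding y_def using assms by (intro cos_error_le_residual) auto
  also have "\<dots> \<le> s ^ 3"
    using e s zero_le_power2[of "s / 2 - y"] zero_le_power[of s 3] sq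
    unfolding res by linarith
  finally show "\<bar>cos_value t (-1/12) - cos t\<bar> \<le> t * t ^ 5"
    by (simp add: s_def eval_nat_numeral)
qed simp

text \<open>The residual is at most \<open>4 * (m / t\<^sup>2) * (t\<^sup>2 / 2)\<^sup>2 = m *
  t\<^sup>2\<close>. The parameter \<open>m\<close> stays free so that it can absorb a factor
  \<open>h\<close> later.\<close>

lemma angle_error_gamma_o:
  fixes t \<gamma> m :: real
  assumes "0 < t" "t \<le> 1" "-1/6 \<le> \<gamma>" "\<gamma> \<le> 1/6" "\<bar>\<gamma> - gamma_o t\<bar> \<le> m / t\<^sup>2"
  shows "\<bar>t_minus t \<gamma> - t\<bar> \<le> 18 * (m * t)"
proof (rule angle_error[OF assms(1-3)])
  \<comment> \<open>Hence \<open>1 - cos t\<close> is nonzero and the denominator of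
    \<open>gamma_o t\<close> can be cleared.\<close>
  have "cos t < cos 0"
    using assms(1,2) pi_ge_two by (intro cos_monotone_0_pi) auto
  then have "12 * gamma_o t * (1 - cos t)\<^sup>2 = 6 * cos t - 6 + t\<^sup>2 * cos t + 2 * t\<^sup>2"
    by (simp add: gamma_o_def)
  then have res: "2 * (1 + t\<^sup>2 / 6) * (1 - cos t) + 4 * \<gamma> * (1 - cos t)\<^sup>2 - t\<^sup>2
      = 4 * (\<gamma> - gamma_o t) * (1 - cos t)\<^sup>2"
    by (simp add: field_simps)
  have "\<bar>cos_value t \<gamma> - cos t\<bar> \<le> \<bar>4 * (\<gamma> - gamma_o t) * (1 - cos t)\<^sup>2\<bar>"
    using cos_error_le_residual[OF assms(1-4)] unfolding res .
  also have "\<dots> = 4 * \<bar>\<gamma> - gamma_o t\<bar> * (1 - cos t)\<^sup>2"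
    by (simp only: abs_mult abs_numeral abs_power2)
  also have "\<dots> \<le> 4 * (m / t\<^sup>2) * (t\<^sup>2 / 2)\<^sup>2"
    \<comment> \<open>The \<open>order_trans\<close> fact supplies
      \<open>0 \<le> m / t\<^sup>2\<close>, which the monotonicity of products needs.\<close>
    using assms(5) one_minus_cos_le[of t] order_trans[OF abs_ge_zero assms(5)]
    by (intro mult_mono power_mono) auto
  also have "\<dots> = t * (m * t)"
    using assms(1) by (simp add: field_simps power2_eq_square)
  finally show "\<bar>cos_value t \<gamma> - cos t\<bar> \<le> t * (m * t)" .
qed

section \<open>From angles back to wave numbers\<close>

lemma k_minus_error:
  assumes "0 < h" "\<bar>t_minus (k * h) \<gamma> - k * h\<bar> \<le> e * h"
  shows "\<bar>k_minus k h \<gamma> - k\<bar> \<le> e"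
proof -
  have "k_minus k h \<gamma> - k = (t_minus (k * h) \<gamma> - k * h) / h"
    using assms(1) by (simp add: k_minus_def field_simps)
  then show ?thesis using assms by (simp add: pos_divide_le_eq)
qed

theorem lemma4p1:
  shows "(\<exists>C::real. C > 0 \<and>
            (\<forall>k h \<gamma> :: real. 0 < k \<longrightarrow> 0 < h \<longrightarrow> k * h \<le> 1 \<longrightarrow> -1/6 \<le> \<gamma> \<longrightarrow> \<gamma> \<le> 1/6 \<longrightarrow>
               (\<bar>cos (t_minus (k * h) \<gamma>) - 1 + (k * h)\<^sup>2 / 2\<bar> \<le> 1/6 * (k * h)^4 \<and>
                \<bar>k_minus k h \<gamma> - k\<bar> \<le> C * k^3 * h^2) \<and>
               (\<gamma> = -1/12 \<longrightarrow> \<bar>k_minus k h \<gamma> - k\<bar> \<le> C * k^5 * h^4))) \<and>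
         (\<forall>M::real. M > 0 \<longrightarrow> (\<exists>C\<^sub>M::real. C\<^sub>M > 0 \<and>
            (\<forall>k h \<gamma> :: real. 0 < k \<longrightarrow> 0 < h \<longrightarrow> k * h \<le> 1 \<longrightarrow> -1/6 \<le> \<gamma> \<longrightarrow> \<gamma> \<le> 1/6 \<longrightarrow>
               \<bar>\<gamma> - gamma_o (k * h)\<bar> \<le> M / (k^2 * h) \<longrightarrow>
               \<bar>k_minus k h \<gamma> - k\<bar> \<le> C\<^sub>M * k * h)))"
proof (intro conjI allI impI)
  show "\<exists>C::real. C > 0 \<and>
      (\<forall>k h \<gamma> :: real. 0 < k \<longrightarrow> 0 < h \<longrightarrow> k * h \<le> 1 \<longrightarrow> -1/6 \<le> \<gamma> \<longrightarrow> \<gamma> \<le> 1/6 \<longrightarrow>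
         (\<bar>cos (t_minus (k * h) \<gamma>) - 1 + (k * h)\<^sup>2 / 2\<bar> \<le> 1/6 * (k * h)^4 \<and>
          \<bar>k_minus k h \<gamma> - k\<bar> \<le> C * k^3 * h^2) \<and>
         (\<gamma> = -1/12 \<longrightarrow> \<bar>k_minus k h \<gamma> - k\<bar> \<le> C * k^5 * h^4))"
  \<comment> \<open>The 18 of \<open>angle_diff_le_cos_diff\<close> serves both estimates, as each
    cosine error is at most \<open>t\<close> times the required power of \<open>t\<close>.\<close>
  proof (intro exI[of _ 18] conjI allI impI)
    fix k h \<gamma> :: real
    assume kh: "0 < k" "0 < h" "k * h \<le> 1" "-1/6 \<le> \<gamma>" "\<gamma> \<le> 1/6"
    have "0 < k * h" using kh by simp
    note kh' = this kh(3-5)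
    show "\<bar>cos (t_minus (k * h) \<gamma>) - 1 + (k * h)\<^sup>2 / 2\<bar> \<le> 1/6 * (k * h)^4"
      using cos_value_bounds(3)[OF kh'] t_minus_works(3)[OF kh'(1-3)] by linarith
    show "\<bar>k_minus k h \<gamma> - k\<bar> \<le> 18 * k^3 * h^2"
      using angle_error_general[OF kh'] kh(2)
      by (intro k_minus_error) (simp_all add: power_mult_distrib eval_nat_numeral mult_ac)
    show "\<bar>k_minus k h \<gamma> - k\<bar> \<le> 18 * k^5 * h^4" if "\<gamma> = -1/12"
      using angle_error_superconvergent[OF kh'(1,2)] kh(2) unfolding that
      by (intro k_minus_error) (simp_all add: power_mult_distrib eval_nat_numeral mult_ac)
  qed simp
  fix M :: real
  assume M: "M > 0"
  show "\<exists>C\<^sub>M::real. C\<^sub>M > 0 \<and>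
      (\<forall>k h \<gamma> :: real. 0 < k \<longrightarrow> 0 < h \<longrightarrow> k * h \<le> 1 \<longrightarrow> -1/6 \<le> \<gamma> \<longrightarrow> \<gamma> \<le> 1/6 \<longrightarrow>
         \<bar>\<gamma> - gamma_o (k * h)\<bar> \<le> M / (k^2 * h) \<longrightarrow>
         \<bar>k_minus k h \<gamma> - k\<bar> \<le> C\<^sub>M * k * h)"
  proof (intro exI[of _ "18 * M"] conjI allI impI)
    fix k h \<gamma> :: real
    assume kh: "0 < k" "0 < h" "k * h \<le> 1" "-1/6 \<le> \<gamma>" "\<gamma> \<le> 1/6"
      and g: "\<bar>\<gamma> - gamma_o (k * h)\<bar> \<le> M / (k^2 * h)"
    have "0 < k * h" using kh by simp
    note kh' = this kh(3-5)
    \<comment> \<open>In terms of \<open>t = k * h\<close> the hypothesis has the form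
      \<open>m / t\<^sup>2\<close> with \<open>m = M * h\<close>; this extra \<open>h\<close>
      cancels against the division by \<open>h\<close> in \<open>k_minus\<close>.\<close>
    have "M / (k^2 * h) = M * h / (k * h)\<^sup>2"
      using kh by (simp add: power2_eq_square field_simps)
    then have "\<bar>t_minus (k * h) \<gamma> - k * h\<bar> \<le> 18 * (M * h * (k * h))"
      using g by (intro angle_error_gamma_o[OF kh']) simp
    then show "\<bar>k_minus k h \<gamma> - k\<bar> \<le> 18 * M * k * h"
      using kh(2) by (intro k_minus_error) (simp_all add: mult_ac)
  qed (use M in simp)
qed

end
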